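(* Let $\mathcal{M}$ be a finite set of $M$ user equipments (UEs) and $\mathcal{N}=\mathcal{N}_1\cup\mathcal{N}_2$ a finite set of base stations (BSs), where $\mathcal{N}_1$ is the set of millimeter-wave (mmW) BSs and $\mathcal{N}_2$ the disjoint set of microwave ($\mu$W) BSs. Let each BS $n\in\mathcal{N}$ have a minimum quota $q_n^{\min}$ and a maximum quota $q_n^{\max}$ with $0\le q_n^{\min}\le q_n^{\max}$, and suppose $\sum_{n\in\mathcal{N}}q_n^{\min}\le M\le\sum_{n\in\mathcal{N}}q_n^{\max}$. Let the UEs have the preference relations $\succ_m$ ($m\in\mathcal{M}$) and let all BSs use the common master-list preference relation $\succ_{\mathrm{ML}}$, i.e. $\succ_n\equiv\succ_{\mathrm{ML}}$ for all $n\in\mathcal{N}$, where these relations are induced by utilities as described in the context. Then the matching with minimum quota (MMQ) algorithm described in the context is guaranteed to yield a feasible Pareto optimal and stable matching between UEs and BSs.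
   Context: Preferences. A preference relation is a complete, reflexive and transitive binary relation. The utility of UE $m$ for BS $n$ is $U_m(n)=\log\left[f_{m,n}c^{\mathrm{LoS}}_{m,n}+(1-f_{m,n})c^{\mathrm{NLoS}}_{m,n}\right]$ if $n\in\mathcal{N}_1$, and $U_m(n)=\log\left[c^{\mu\mathrm{W}}_{m,n}\right]$ if $n\in\mathcal{N}_2$. Here $c^{\mathrm{LoS}}_{m,n}$ and $c^{\mathrm{NLoS}}_{m,n}$ are the achievable rates per unit bandwidth of the mmW link from $n$ to $m$ when it is line-of-sight (LoS) and non-line-of-sight, respectively, $c^{\mu\mathrm{W}}_{m,n}$ is the achievable rate per unit bandwidth of the $\mu$W link, and $f_{m,n}$ is the UE's moving-average estimate of the probability that the mmW link is LoS. It is updated by $f_{m,n}(t)=\lambda\,k_{m,n}(t)x_{m,n}/k+(1-\lambda)f_{m,n}(t-1)$, where $\lambda$ is a constant between $0$ and $1$, $k_{m,n}(t)$ is the number of successful LoS transmissions from $n$ to $m$, $k$ is the number of transmission slots in the window in which the association is not updated, and $x_{m,n}\in\{0,1\}$ indicates whether $m$ is assigned to $n$. The preference relation of UE $m$ is given by $n\succ_m n'\Leftrightarrow U_m(n)\ge U_m(n')$ for $n,n'\in\mathcal{N}$. The master list is given by $m\succ_{\mathrm{ML}}m'\Leftrightarrow U_{\mathrm{ML}}(m)\ge U_{\mathrm{ML}}(m')$, where $U_{\mathrm{ML}}(m)$ is the utility of $m$ at its preferred BS, i.e. the value $U_m(n')$ with $U_m(n')\ge U_m(n)$ for all $n\in\mathcal{N}$.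 Matchings. A (one-to-many) matching $\pi$ satisfies $\pi(n)\subseteq\mathcal{M}$ for all $n\in\mathcal{N}$, $\pi(m)\in\mathcal{N}$ for all $m\in\mathcal{M}$, and $\pi(m)=n$ if and only if $m\in\pi(n)$. It is feasible if it satisfies the quota constraints: each UE is assigned to at most one BS, and $q_n^{\min}\le|\pi(n)|\le q_n^{\max}$ for all $n\in\mathcal{N}$. A UE compares two matchings by comparing the BSs they assign to it. A matching $\pi$ is Pareto optimal if there is no other feasible matching $\pi'$ that is preferred by all UEs over $\pi$ ($\pi'\succeq_m\pi$ for all $m\in\mathcal{M}$) and strictly preferred over $\pi$ by some UEs ($\pi'\succ_m\pi$ for some $m\in\mathcal{M}$). A pair $(m,n)\notin\pi$ (i.e. $m$ is not assigned to $n$) is a blocking pair of $\pi$ if and only if $m\succ_n m'$ for some $m'\in\pi(n)$ and $n\succ_m\pi(m)$. A matching is stable if it has no blocking pair. MMQ algorithm. Inputs: $\succ_{\mathrm{ML}}$, $\succ_m$ for all $m\in\mathcal{M}$, and $q_n^{\max},q_n^{\min}$ for all $n\in\mathcal{N}$. Output: $\pi$. Let $\kappa_n=|\pi(n)|$ be the number of UEs currently assigned to $n$, and $\lfloor x\rfloor^+=\max(x,0)$. (1) Initialize $\pi(m)=\emptyset$ for all $m\in\mathcal{M}$ and $\mathcal{M}'=\mathcal{M}$. (2) Choose the UE $m^*\in\mathcal{M}'$ with the highest rank in the master list, i.e. $m^*\succ_{\mathrm{ML}}m$ for all $m\in\mathcal{M}'$. (3) Let $\pi(m^* )=n$, where $n$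 is the most preferred BS based on $\succ_{m^*}$ with $\kappa_n<q_n^{\max}$; add $m^*$ to $\pi(n)$ and remove it from $\mathcal{M}'$. (4) Repeat (2) and (3) until $\sum_{n\in\mathcal{N}}\lfloor q_n^{\min}-\kappa_n\rfloor^+=|\mathcal{M}'|$ (a repeat–until loop: the condition is tested after an assignment has been made). (5) While $\mathcal{M}'\neq\emptyset$: choose the UE $m^*\in\mathcal{M}'$ with the highest rank in the master list; let $\pi(m^* )=n$, where $n$ is the most preferred BS based on $\succ_{m^*}$ with $\kappa_n<q_n^{\min}$; add $m^*$ to $\pi(n)$ and remove it from $\mathcal{M}'$.
   Formalization: Added: there is at least one UE; no UE is indifferent between two BSs (else Pareto optimality can fail); if the minimum quotas sum to M, the first assignment goes to a BS with positive minimum quota (else the loop never exits). Blocking pairs use strict preference. *)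

theory Defs
  imports Complex_Main
begin

(* Preference relations are weak (reflexive, complete, transitive); strict preference is the
   asymmetric part of the weak relation. *)

definition utility_pref :: "('a \<Rightarrow> real) \<Rightarrow> 'a \<Rightarrow> 'a \<Rightarrow> bool" where
  "utility_pref u a b \<longleftrightarrow> u a \<ge> u b"

definition strict_pref :: "('a \<Rightarrow> 'a \<Rightarrow> bool) \<Rightarrow> 'a \<Rightarrow> 'a \<Rightarrow> bool" where
  "strict_pref R a b \<longleftrightarrow> R a b \<and> \<not> R b a"

definition mmw_rate ::
  "('m \<Rightarrow> 'n \<Rightarrow> real) \<Rightarrow> ('m \<Rightarrow> 'n \<Rightarrow> real) \<Rightarrow> ('m \<Rightarrow> 'n \<Rightarrow> real) \<Rightarrow> 'm \<Rightarrow> 'n \<Rightarrow> real" where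
  "mmw_rate f c_LoS c_NLoS m n = f m n * c_LoS m n + (1 - f m n) * c_NLoS m n"

definition ue_utility ::
  "'n set \<Rightarrow> ('m \<Rightarrow> 'n \<Rightarrow> real) \<Rightarrow> ('m \<Rightarrow> 'n \<Rightarrow> real) \<Rightarrow> ('m \<Rightarrow> 'n \<Rightarrow> real) \<Rightarrow>
   ('m \<Rightarrow> 'n \<Rightarrow> real) \<Rightarrow> 'm \<Rightarrow> 'n \<Rightarrow> real" where
  "ue_utility N1 f c_LoS c_NLoS c_uW m n =
     (if n \<in> N1 then ln (mmw_rate f c_LoS c_NLoS m n) else ln (c_uW m n))"

definition ml_utility :: "'n set \<Rightarrow> ('m \<Rightarrow> 'n \<Rightarrow> real) \<Rightarrow> 'm \<Rightarrow> real" where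
  "ml_utility N U m = Max (U m ` N)"

(* A (partial) assignment is a finite map from UEs to BSs, so a UE has at most one BS and
   "pi(m) = n iff m is in pi(n)" holds by construction; "assigned pi n" is the set pi(n). *)

definition assigned :: "('m \<rightharpoonup> 'n) \<Rightarrow> 'n \<Rightarrow> 'm set" where
  "assigned \<pi> n = {m. \<pi> m = Some n}"

definition load :: "('m \<rightharpoonup> 'n) \<Rightarrow> 'n \<Rightarrow> nat" where
  "load \<pi> n = card (assigned \<pi> n)"

definition matching :: "'m set \<Rightarrow> 'n set \<Rightarrow> ('m \<rightharpoonup> 'n) \<Rightarrow> bool" where
  "matching M N \<pi> \<longleftrightarrow> dom \<pi> = M \<and> ran \<pi> \<subseteq> N"

definition feasible ::
  "'m set \<Rightarrow> 'n set \<Rightarrow> ('n \<Rightarrow> nat) \<Rightarrow> ('n \<Rightarrow> nat) \<Rightarrow> ('m \<rightharpoonup> 'n) \<Rightarrow> bool" where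
  "feasible M N qmin qmax \<pi> \<longleftrightarrow>
     matching M N \<pi> \<and> (\<forall>n\<in>N. qmin n \<le> load \<pi> n \<and> load \<pi> n \<le> qmax n)"

definition pareto_optimal ::
  "'m set \<Rightarrow> 'n set \<Rightarrow> ('n \<Rightarrow> nat) \<Rightarrow> ('n \<Rightarrow> nat) \<Rightarrow> ('m \<Rightarrow> 'n \<Rightarrow> 'n \<Rightarrow> bool) \<Rightarrow>
   ('m \<rightharpoonup> 'n) \<Rightarrow> bool" where
  "pareto_optimal M N qmin qmax ue_pref \<pi> \<longleftrightarrow>
     \<not> (\<exists>\<pi>'. feasible M N qmin qmax \<pi>' \<and>
            (\<forall>m\<in>M. ue_pref m (the (\<pi>' m)) (the (\<pi> m))) \<and>
            (\<exists>m\<in>M. strict_pref (ue_pref m) (the (\<pi>' m)) (the (\<pi> m))))"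

definition blocking_pair ::
  "'m set \<Rightarrow> 'n set \<Rightarrow> ('m \<Rightarrow> 'n \<Rightarrow> 'n \<Rightarrow> bool) \<Rightarrow> ('n \<Rightarrow> 'm \<Rightarrow> 'm \<Rightarrow> bool) \<Rightarrow>
   ('m \<rightharpoonup> 'n) \<Rightarrow> 'm \<Rightarrow> 'n \<Rightarrow> bool" where
  "blocking_pair M N ue_pref bs_pref \<pi> m n \<longleftrightarrow>
     m \<in> M \<and> n \<in> N \<and> \<pi> m \<noteq> Some n \<and>
     (\<exists>m'\<in>assigned \<pi> n. strict_pref (bs_pref n) m m') \<and>
     strict_pref (ue_pref m) n (the (\<pi> m))"

definition stable_matching ::
  "'m set \<Rightarrow> 'n set \<Rightarrow> ('m \<Rightarrow> 'n \<Rightarrow> 'n \<Rightarrow> bool) \<Rightarrow> ('n \<Rightarrow> 'm \<Rightarrow> 'm \<Rightarrow> bool) \<Rightarrow>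
   ('m \<rightharpoonup> 'n) \<Rightarrow> bool" where
  "stable_matching M N ue_pref bs_pref \<pi> \<longleftrightarrow>
     \<not> (\<exists>m n. blocking_pair M N ue_pref bs_pref \<pi> m n)"

(* When no utilities are tied, it makes no difference whether blocking pairs are defined with
   strict or with weak preference. *)

lemma blocking_pair_weak_iff:
  assumes "matching M N \<pi>"
    and "\<And>m. m \<in> M \<Longrightarrow> inj_on (U m) N"
    and "inj_on V M"
  shows "blocking_pair M N (\<lambda>m. utility_pref (U m)) (\<lambda>n. utility_pref V) \<pi> m n \<longleftrightarrow>
     m \<in> M \<and> n \<in> N \<and> \<pi> m \<noteq> Some n \<and>
     (\<exists>m'\<in>assigned \<pi> n. utility_pref V m m') \<and> utility_pref (U m) n (the (\<pi> m))"
proof -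
  have ue: "strict_pref (utility_pref (U m)) n (the (\<pi> m)) \<longleftrightarrow> utility_pref (U m) n (the (\<pi> m))"
    if "m \<in> M" "n \<in> N" "\<pi> m \<noteq> Some n"
  proof -
    from that assms(1) obtain n' where n': "\<pi> m = Some n'" "n' \<in> N"
      unfolding matching_def by (auto simp: ran_def)
    then have "U m n \<noteq> U m n'"
      using that assms(2) inj_onD by fastforce
    then show ?thesis using n' by (auto simp: strict_pref_def utility_pref_def)
  qed
  have bs: "strict_pref (utility_pref V) m m' \<longleftrightarrow> utility_pref V m m'"
    if "m \<in> M" "\<pi> m \<noteq> Some n" "m' \<in> assigned \<pi> n" for m'
  proof -
    have "m' \<in> M" "m' \<noteq> m"
      using that assms(1) by (auto simp: assigned_def matching_def)
    then have "V m \<noteq> V m'"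
      using that assms(3) by (auto dest: inj_onD)
    then show ?thesis by (auto simp: strict_pref_def utility_pref_def)
  qed
  show ?thesis unfolding blocking_pair_def using ue bs by blast
qed

definition highest_ranked :: "('m \<Rightarrow> 'm \<Rightarrow> bool) \<Rightarrow> 'm set \<Rightarrow> 'm \<Rightarrow> bool" where
  "highest_ranked ml M' m \<longleftrightarrow> m \<in> M' \<and> (\<forall>m'\<in>M'. ml m m')"

definition most_preferred ::
  "'n set \<Rightarrow> ('n \<Rightarrow> 'n \<Rightarrow> bool) \<Rightarrow> ('n \<Rightarrow> nat) \<Rightarrow> ('m \<rightharpoonup> 'n) \<Rightarrow> 'n \<Rightarrow> bool" where
  "most_preferred N R cap \<pi> n \<longleftrightarrow>
     n \<in> N \<and> load \<pi> n < cap n \<and> (\<forall>n'\<in>N. load \<pi> n' < cap n' \<longrightarrow> R n n')"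

(* The two loops of the algorithm, with the current assignment and the set of unassigned UEs. *)

datatype ('m, 'n) mmq_state =
    Repeat_Loop "'m \<rightharpoonup> 'n" "'m set"
  | While_Loop "'m \<rightharpoonup> 'n" "'m set"

(* Truncated subtraction on nat is the positive part of the difference. *)

definition deficit :: "'n set \<Rightarrow> ('n \<Rightarrow> nat) \<Rightarrow> ('m \<rightharpoonup> 'n) \<Rightarrow> nat" where
  "deficit N qmin \<pi> = (\<Sum>n\<in>N. qmin n - load \<pi> n)"

(* The exit condition of the repeat-until loop is tested after each assignment, never before the
   first one. A Repeat_Loop state without unassigned UEs is stuck. *)

inductive mmq_step ::
  "'n set \<Rightarrow> ('n \<Rightarrow> nat) \<Rightarrow> ('n \<Rightarrow> nat) \<Rightarrow> ('m \<Rightarrow> 'n \<Rightarrow> 'n \<Rightarrow> bool) \<Rightarrow> ('m \<Rightarrow> 'm \<Rightarrow> bool) \<Rightarrow>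
   ('m, 'n) mmq_state \<Rightarrow> ('m, 'n) mmq_state \<Rightarrow> bool"
  for N qmin qmax ue_pref ml where
  repeat_continue:
    "\<lbrakk>highest_ranked ml M' m; most_preferred N (ue_pref m) qmax \<pi> n;
      \<pi>' = \<pi>(m \<mapsto> n); M'' = M' - {m}; deficit N qmin \<pi>' \<noteq> card M''\<rbrakk>
     \<Longrightarrow> mmq_step N qmin qmax ue_pref ml (Repeat_Loop \<pi> M') (Repeat_Loop \<pi>' M'')"
| repeat_exit:
    "\<lbrakk>highest_ranked ml M' m; most_preferred N (ue_pref m) qmax \<pi> n;
      \<pi>' = \<pi>(m \<mapsto> n); M'' = M' - {m}; deficit N qmin \<pi>' = card M''\<rbrakk>
     \<Longrightarrow> mmq_step N qmin qmax ue_pref ml (Repeat_Loop \<pi> M') (While_Loop \<pi>' M'')"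
| while_step:
    "\<lbrakk>highest_ranked ml M' m; most_preferred N (ue_pref m) qmin \<pi> n;
      \<pi>' = \<pi>(m \<mapsto> n); M'' = M' - {m}\<rbrakk>
     \<Longrightarrow> mmq_step N qmin qmax ue_pref ml (While_Loop \<pi> M') (While_Loop \<pi>' M'')"

(* Total correctness over all runs (runs differ only in how ties are resolved): no run is
   infinite, and every state where a run stops is an exit from the while loop whose matching
   satisfies P. *)

definition mmq_guarantees ::
  "'m set \<Rightarrow> 'n set \<Rightarrow> ('n \<Rightarrow> nat) \<Rightarrow> ('n \<Rightarrow> nat) \<Rightarrow> ('m \<Rightarrow> 'n \<Rightarrow> 'n \<Rightarrow> bool) \<Rightarrow>
   ('m \<Rightarrow> 'm \<Rightarrow> bool) \<Rightarrow> (('m \<rightharpoonup> 'n) \<Rightarrow> bool) \<Rightarrow> bool" where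
  "mmq_guarantees M N qmin qmax ue_pref ml P \<longleftrightarrow>
     \<not> (\<exists>s. s 0 = Repeat_Loop Map.empty M \<and>
           (\<forall>i::nat. mmq_step N qmin qmax ue_pref ml (s i) (s (Suc i)))) \<and>
     (\<forall>s. (mmq_step N qmin qmax ue_pref ml)\<^sup>*\<^sup>* (Repeat_Loop Map.empty M) s \<longrightarrow>
          \<not> (\<exists>s'. mmq_step N qmin qmax ue_pref ml s s') \<longrightarrow>
          (\<exists>\<pi>. s = While_Loop \<pi> {} \<and> P \<pi>))"

end

theory Submission
  imports Defs
begin

text \<open>
  At every moment of a run, the partial assignment built so far is forced: any feasible matching
  that is at least as good for all UEs already served agrees with it on them. A UE denied a
  better BS in the first loop meets a full BS. In the second loop the number of unserved UEs
  equals the total deficit, so every feasible completion spends all of them on BSs below their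
  minimum quota, and a BS that has reached it is closed as well. Since closed BSs stay closed,
  nobody who is ranked lower can later take a place that was denied, which gives stability.
\<close>

section \<open>Loads and deficits when one UE is assigned\<close>

lemma load_upd:
  assumes "finite (dom \<pi>)" "m \<notin> dom \<pi>"
  shows "load (\<pi>(m \<mapsto> n)) n' = load \<pi> n' + of_bool (n' = n)"
proof -
  have "finite (assigned \<pi> n')"
    using assms(1) by (rule rev_finite_subset) (auto simp: assigned_def)
  moreover have "assigned (\<pi>(m \<mapsto> n)) n' =
      (if n' = n then insert m (assigned \<pi> n') else assigned \<pi> n')"
    using assms(2) by (auto simp: assigned_def)
  moreover have "m \<notin> assigned \<pi> n'"
    using assms(2) by (auto simp: assigned_def)
  ultimately show ?thesis by (cases "n' = n") (simp_all add: load_def)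
qed

lemma sum_load:
  assumes "finite N" "finite (dom \<pi>)" "ran \<pi> \<subseteq> N"
  shows "(\<Sum>n\<in>N. load \<pi> n) = card (dom \<pi>)"
proof -
  have "dom \<pi> = (\<Union>n\<in>N. assigned \<pi> n)"
    using assms(3) by (auto simp: assigned_def ran_def)
  moreover have "card (\<Union>n\<in>N. assigned \<pi> n) = (\<Sum>n\<in>N. card (assigned \<pi> n))"
  proof (rule card_UN_disjoint[OF assms(1)])
    show "\<forall>n\<in>N. finite (assigned \<pi> n)"
      using assms(2) by (auto simp: assigned_def intro: rev_finite_subset)
  qed (auto simp: assigned_def)
  ultimately show ?thesis by (simp add: load_def)
qed

lemma load_mono:
  assumes "finite (dom \<pi>')" "\<pi> \<subseteq>\<^sub>m \<pi>'"
  shows "load \<pi> n \<le> load \<pi>' n"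
  unfolding load_def
proof (rule card_mono)
  show "finite (assigned \<pi>' n)"
    using assms(1) by (rule rev_finite_subset) (auto simp: assigned_def)
  show "assigned \<pi> n \<subseteq> assigned \<pi>' n"
    using assms(2) by (force simp: assigned_def map_le_def dom_def)
qed

lemma deficit_upd_le:
  assumes "finite (dom \<pi>)" "m \<notin> dom \<pi>"
  shows "deficit N qmin (\<pi>(m \<mapsto> n)) \<le> deficit N qmin \<pi>"
  unfolding deficit_def load_upd[OF assms] by (rule sum_mono) simp

lemma Suc_deficit_upd:
  assumes "finite (dom \<pi>)" "m \<notin> dom \<pi>" "finite N" "n \<in> N" "load \<pi> n < qmin n"
  shows "Suc (deficit N qmin (\<pi>(m \<mapsto> n))) = deficit N qmin \<pi>"
proof -
  have "(\<Sum>n'\<in>N - {n}. qmin n' - load (\<pi>(m \<mapsto> n)) n') = (\<Sum>n'\<in>N - {n}. qmin n' - load \<pi> n')"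
    by (rule sum.cong) (auto simp: load_upd[OF assms(1,2)])
  then show ?thesis
    using assms by (simp add: deficit_def sum.remove[of N n] load_upd)
qed

section \<open>Existence of the choices made by the algorithm\<close>

lemma highest_ranked_exists:
  fixes V :: "'m \<Rightarrow> real"
  assumes "finite A" "A \<noteq> {}"
  shows "\<exists>m. highest_ranked (utility_pref V) A m"
proof -
  have "Max (V ` A) \<in> V ` A"
    using assms by (intro Max_in) auto
  then obtain m where "m \<in> A" "V m = Max (V ` A)"
    by (metis imageE)
  then show ?thesis
    using assms by (auto simp: highest_ranked_def utility_pref_def intro!: exI[of _ m])
qed

lemma most_preferred_exists:
  fixes u :: "'n \<Rightarrow> real"
  assumes "finite N" "\<exists>n\<in>N. load \<pi> n < cap n"
  shows "\<exists>n. most_preferred N (utility_pref u) cap \<pi> n"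
proof -
  \<comment> \<open>A most preferred open BS is a highest-ranked element among the open ones, so the
    lemma on UEs is reused with BSs.\<close>
  have "\<exists>n. highest_ranked (utility_pref u) {n\<in>N. load \<pi> n < cap n} n"
    using assms by (intro highest_ranked_exists) auto
  then show ?thesis
    by (auto simp: highest_ranked_def most_preferred_def)
qed

section \<open>Where a feasible completion can place an unserved UE\<close>

text \<open>By counting: a feasible completion loads each BS with at least the larger of its current
  load and its minimum quota. Under \<open>tight\<close> these bounds already add up to
  \<open>card M\<close>, so placing \<open>m\<close> at a BS that has met its minimum would require
  more UEs than exist.\<close>

lemma feasible_completion_below_qmin:
  assumes fin: "finite M" "finite N"
    and feas: "feasible M N qmin qmax \<pi>'"
    and le: "\<pi> \<subseteq>\<^sub>m \<pi>'"
    and tight: "deficit N qmin \<pi> = card (M - dom \<pi>)"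
    and m: "m \<in> M - dom \<pi>"
  shows "load \<pi> (the (\<pi>' m)) < qmin (the (\<pi>' m))"
proof (rule ccontr)
  assume full: "\<not> ?thesis"
  have dom': "dom \<pi>' = M" and ran': "ran \<pi>' \<subseteq> N"
    and quota: "\<And>n. n \<in> N \<Longrightarrow> qmin n \<le> load \<pi>' n"
    using feas by (simp_all add: feasible_def matching_def)
  have sub: "dom \<pi> \<subseteq> M"
    using map_le_implies_dom_le[OF le] dom' by simp
  have ran: "ran \<pi> \<subseteq> N"
    using ran' le by (force simp: map_le_def ran_def)
  have fin_dom: "finite (dom \<pi>)" "finite (dom \<pi>')"
    using fin sub dom' by (auto intro: finite_subset)
  obtain n where n: "\<pi>' m = Some n" "n \<in> N"
    using m dom' ran' by (fastforce simp: ran_def)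
  have le_upd: "\<pi>(m \<mapsto> n) \<subseteq>\<^sub>m \<pi>'"
    using le n by (auto simp: map_le_def)
  \<comment> \<open>Since subtraction truncates, the left side is the maximum of
    \<open>load \<pi> i\<close> and \<open>qmin i\<close>.\<close>
  have "load \<pi> i + (qmin i - load \<pi> i) \<le> load \<pi>' i" if "i \<in> N" for i
    using quota[OF that] load_mono[OF fin_dom(2) le, of i] by simp
  moreover have "load \<pi> n + (qmin n - load \<pi> n) < load \<pi>' n"
    using full n load_mono[OF fin_dom(2) le_upd, of n] m by (simp add: load_upd[OF fin_dom(1)])
  ultimately have "(\<Sum>i\<in>N. load \<pi> i + (qmin i - load \<pi> i)) < (\<Sum>i\<in>N. load \<pi>' i)"
    using fin n by (intro sum_strict_mono_ex1) auto
  also have "\<dots> = card M"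
    using sum_load[OF fin(2) fin_dom(2) ran'] dom' by simp
  also have "(\<Sum>i\<in>N. load \<pi> i + (qmin i - load \<pi> i)) = card (dom \<pi>) + card (M - dom \<pi>)"
    using sum_load[OF fin(2) fin_dom(1) ran] tight by (simp add: sum.distrib deficit_def)
  also have "\<dots> = card M"
    using fin sub by (metis card_Diff_subset card_mono fin_dom(1) le_add_diff_inverse)
  finally show False by simp
qed

lemma feasible_completion_below_qmax:
  assumes fin: "finite M"
    and feas: "feasible M N qmin qmax \<pi>'"
    and le: "\<pi> \<subseteq>\<^sub>m \<pi>'"
    and m: "m \<in> M - dom \<pi>"
  shows "load \<pi> (the (\<pi>' m)) < qmax (the (\<pi>' m))"
proof -
  have dom': "dom \<pi>' = M" and ran': "ran \<pi>' \<subseteq> N"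
    and quota: "\<And>n. n \<in> N \<Longrightarrow> load \<pi>' n \<le> qmax n"
    using feas by (simp_all add: feasible_def matching_def)
  obtain n where n: "\<pi>' m = Some n" "n \<in> N"
    using m dom' ran' by (fastforce simp: ran_def)
  have "finite (dom \<pi>)"
    using fin map_le_implies_dom_le[OF le] dom' by (auto intro: finite_subset)
  moreover have "\<pi>(m \<mapsto> n) \<subseteq>\<^sub>m \<pi>'"
    using le n by (auto simp: map_le_def)
  ultimately have "Suc (load \<pi> n) \<le> load \<pi>' n"
    using load_mono[of \<pi>' "\<pi>(m \<mapsto> n)" n] fin dom' m by (simp add: load_upd)
  then show ?thesis
    using n quota[of n] by simp
qed

section \<open>The market and the loop invariant\<close>

text \<open>\<open>V\<close> is the utility behind the master list and may have ties.
  \<open>M_nonempty\<close> keeps the start state from being stuck. \<open>tight\<close> concerns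
  the iteration that is executed before the exit test: if the minimum quotas claim every UE, a first
  choice with minimum quota 0 would leave a deficit larger than the number of remaining UEs.\<close>

locale mmq_market =
  fixes M :: "'m set" and N :: "'n set" and qmin qmax :: "'n \<Rightarrow> nat"
    and U :: "'m \<Rightarrow> 'n \<Rightarrow> real" and V :: "'m \<Rightarrow> real"
  assumes finM: "finite M" and M_nonempty: "M \<noteq> {}" and finN: "finite N"
    and qmin_le_qmax: "\<And>n. n \<in> N \<Longrightarrow> qmin n \<le> qmax n"
    and sum_qmin: "(\<Sum>n\<in>N. qmin n) \<le> card M"
    and sum_qmax: "card M \<le> (\<Sum>n\<in>N. qmax n)"
    and inj_U: "\<And>m. m \<in> M \<Longrightarrow> inj_on (U m) N"
    and tight: "\<And>m n. (\<Sum>n\<in>N. qmin n) = card M \<Longrightarrow> highest_ranked (utility_pref V) M m \<Longrightarrow>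
      most_preferred N (utility_pref (U m)) qmax (Map.empty :: 'm \<rightharpoonup> 'n) n \<Longrightarrow> 0 < qmin n"
begin

abbreviation "ue \<equiv> \<lambda>m. utility_pref (U m)"
abbreviation "step \<equiv> mmq_step N qmin qmax ue (utility_pref V)"

text \<open>For a \<open>\<pi>\<close> defined on all of \<open>M\<close>, this says that no other
  feasible matching weakly dominates it, which is stronger than Pareto optimality. The form for
  partial maps makes it provable one assignment at a time.\<close>

definition forced :: "('m \<rightharpoonup> 'n) \<Rightarrow> bool" where
  "forced \<pi> \<longleftrightarrow> (\<forall>\<pi>'. feasible M N qmin qmax \<pi>' \<longrightarrow>
     (\<forall>m\<in>dom \<pi>. U m (the (\<pi> m)) \<le> U m (the (\<pi>' m))) \<longrightarrow> \<pi> \<subseteq>\<^sub>m \<pi>')"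

definition partial_ok :: "'m set \<Rightarrow> ('m \<rightharpoonup> 'n) \<Rightarrow> bool" where
  "partial_ok M' \<pi> \<longleftrightarrow> M' \<subseteq> M \<and> dom \<pi> = M - M' \<and> ran \<pi> \<subseteq> N \<and>
     (\<forall>n\<in>N. load \<pi> n \<le> qmax n) \<and> (\<forall>m\<in>dom \<pi>. \<forall>m'\<in>M'. V m' \<le> V m) \<and> forced \<pi>"

text \<open>\<open>cap\<close> is \<open>qmax\<close> in the first loop and \<open>qmin\<close> in
  the second. The rank clause excludes blocking pairs; the capacity clause makes it persist, since a
  closed BS receives no further UEs.\<close>

definition envy_closed :: "('n \<Rightarrow> nat) \<Rightarrow> ('m \<rightharpoonup> 'n) \<Rightarrow> bool" where
  "envy_closed cap \<pi> \<longleftrightarrow> (\<forall>m\<in>dom \<pi>. \<forall>n\<in>N. U m (the (\<pi> m)) < U m n \<longrightarrow>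
     cap n \<le> load \<pi> n \<and> (\<forall>m'\<in>assigned \<pi> n. V m \<le> V m'))"

text \<open>
  With total minimum quota \<^term>\<open>card M\<close> the exit condition already holds at the start, where it
  is not tested; the second disjunct below covers this.
\<close>

fun mmq_inv :: "('m, 'n) mmq_state \<Rightarrow> bool" where
  "mmq_inv (Repeat_Loop \<pi> M') \<longleftrightarrow> partial_ok M' \<pi> \<and> envy_closed qmax \<pi> \<and>
     (deficit N qmin \<pi> < card M' \<or> \<pi> = Map.empty \<and> deficit N qmin \<pi> = card M')"
| "mmq_inv (While_Loop \<pi> M') \<longleftrightarrow> partial_ok M' \<pi> \<and> envy_closed qmin \<pi> \<and>
     deficit N qmin \<pi> = card M'"

lemma partial_okD:
  assumes "partial_ok M' \<pi>"
  shows "finite M'" "finite (dom \<pi>)" "M - dom \<pi> = M'" "\<And>m. m \<in> M' \<Longrightarrow> m \<notin> dom \<pi>"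
proof -
  have "M' \<subseteq> M" "dom \<pi> = M - M'"
    using assms by (simp_all add: partial_ok_def)
  then show "finite M'" "finite (dom \<pi>)" "M - dom \<pi> = M'" "\<And>m. m \<in> M' \<Longrightarrow> m \<notin> dom \<pi>"
    using finM finite_subset by auto
qed

section \<open>Preservation of the invariant\<close>

text \<open>By \<open>room\<close>, every feasible completion gives \<open>m\<close> a BS that is
  still open. As \<open>n\<close> is the best of these, a completion that is no worse for
  \<open>m\<close> ties with \<open>n\<close>, and injectivity of \<open>U m\<close> turns the tie
  into equality.\<close>

lemma forced_upd:
  assumes forced: "forced \<pi>" and m: "m \<in> M - dom \<pi>"
    and n: "most_preferred N (ue m) cap \<pi> n"
    and room: "\<And>\<pi>'. feasible M N qmin qmax \<pi>' \<Longrightarrow> \<pi> \<subseteq>\<^sub>m \<pi>' \<Longrightarrow>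
      load \<pi> (the (\<pi>' m)) < cap (the (\<pi>' m))"
  shows "forced (\<pi>(m \<mapsto> n))"
  unfolding forced_def
proof (intro allI impI)
  fix \<pi>'
  assume feas: "feasible M N qmin qmax \<pi>'"
    and better: "\<forall>i\<in>dom (\<pi>(m \<mapsto> n)). U i (the ((\<pi>(m \<mapsto> n)) i)) \<le> U i (the (\<pi>' i))"
  have "U i (the (\<pi> i)) \<le> U i (the (\<pi>' i))" if "i \<in> dom \<pi>" for i
    using bspec[OF better, of i] m that by (cases "i = m") auto
  then have le: "\<pi> \<subseteq>\<^sub>m \<pi>'"
    using forced feas by (auto simp: forced_def)
  obtain n' where n': "\<pi>' m = Some n'" "n' \<in> N"
    using feas m by (fastforce simp: feasible_def matching_def ran_def)
  have "U m n' \<le> U m n"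
    using n n' room[OF feas le] by (auto simp: most_preferred_def utility_pref_def)
  moreover have "U m n \<le> U m n'"
    using better n' by auto
  ultimately have "n' = n"
    using inj_U[of m] m n n' by (auto simp: most_preferred_def dest: inj_onD)
  then show "\<pi>(m \<mapsto> n) \<subseteq>\<^sub>m \<pi>'"
    using le n' by (auto simp: map_le_def)
qed

text \<open>Serves both loops, with \<open>cap\<close> as \<open>qmax\<close> or
  \<open>qmin\<close>; the two lemmas on feasible completions supply \<open>room\<close>.\<close>

lemma partial_ok_upd:
  assumes ok: "partial_ok M' \<pi>" and m: "highest_ranked (utility_pref V) M' m"
    and n: "most_preferred N (ue m) cap \<pi> n"
    and cap: "\<And>n. n \<in> N \<Longrightarrow> cap n \<le> qmax n"
    and room: "\<And>\<pi>'. feasible M N qmin qmax \<pi>' \<Longrightarrow> \<pi> \<subseteq>\<^sub>m \<pi>' \<Longrightarrow>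
      load \<pi> (the (\<pi>' m)) < cap (the (\<pi>' m))"
  shows "partial_ok (M' - {m}) (\<pi>(m \<mapsto> n))"
proof -
  have mM: "m \<in> M'" "m \<notin> dom \<pi>" and rank: "\<And>i. i \<in> M' \<Longrightarrow> V i \<le> V m"
    using m ok by (auto simp: highest_ranked_def utility_pref_def partial_ok_def)
  have nN: "n \<in> N" "load \<pi> n < qmax n"
    using n cap[of n] by (auto simp: most_preferred_def)
  have "forced (\<pi>(m \<mapsto> n))"
    using ok mM n room by (intro forced_upd) (auto simp: partial_ok_def)
  moreover have "\<forall>i\<in>N. load (\<pi>(m \<mapsto> n)) i \<le> qmax i"
    using ok nN by (auto simp: load_upd[OF partial_okD(2)[OF ok] mM(2)] partial_ok_def
        simp del: fun_upd_apply)
  moreover have "ran (\<pi>(m \<mapsto> n)) = insert n (ran \<pi>)"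
    using mM(2) by (intro ran_map_upd) (simp add: domIff)
  ultimately show ?thesis
    using ok mM(1) rank nN(1) unfolding partial_ok_def dom_fun_upd by auto
qed

text \<open>The new UE can envy only closed BSs, and their occupants were served earlier, hence rank
  at least as high. Envy of earlier UEs also points only to closed BSs, which the assignment to an
  open BS leaves untouched.\<close>

lemma envy_closed_upd:
  assumes ok: "partial_ok M' \<pi>" and m: "highest_ranked (utility_pref V) M' m"
    and n: "most_preferred N (ue m) cap \<pi> n"
    and closed: "envy_closed cap \<pi>"
  shows "envy_closed cap (\<pi>(m \<mapsto> n))"
  unfolding envy_closed_def
proof (intro ballI impI)
  fix i j
  assume i: "i \<in> dom (\<pi>(m \<mapsto> n))" and j: "j \<in> N"
    and envy: "U i (the ((\<pi>(m \<mapsto> n)) i)) < U i j"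
  have mM: "m \<in> M'" "m \<notin> dom \<pi>"
    using m ok by (auto simp: highest_ranked_def partial_ok_def)
  have open_n: "load \<pi> n < cap n"
    and best: "\<And>n'. n' \<in> N \<Longrightarrow> U m n < U m n' \<Longrightarrow> cap n' \<le> load \<pi> n'"
    using n by (auto simp: most_preferred_def utility_pref_def not_less[symmetric])
  have "cap j \<le> load \<pi> j \<and> (\<forall>m'\<in>assigned \<pi> j. V i \<le> V m')"
  proof (cases "i = m")
    case True
    have "V m \<le> V m'" if "m' \<in> assigned \<pi> j" for m'
      using that ok mM(1) by (auto simp: partial_ok_def assigned_def)
    then show ?thesis
      using True best j envy by simp
  next
    case False
    then show ?thesis
      using closed i j envy by (auto simp: envy_closed_def)
  qed
  \<comment> \<open>\<open>j\<close> is closed and \<open>n\<close> is open, so they differ.\<close>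
  moreover from this have "assigned (\<pi>(m \<mapsto> n)) j = assigned \<pi> j"
    using open_n mM(2) by (auto simp: assigned_def)
  ultimately show "cap j \<le> load (\<pi>(m \<mapsto> n)) j \<and> (\<forall>m'\<in>assigned (\<pi>(m \<mapsto> n)) j. V i \<le> V m')"
    by (simp add: load_def)
qed

text \<open>Needed at the exit of the repeat loop, where the closing threshold drops from
  \<open>qmax\<close> to \<open>qmin\<close>.\<close>

lemma envy_closed_qmin: "envy_closed qmax \<pi> \<Longrightarrow> envy_closed qmin \<pi>"
  unfolding envy_closed_def using qmin_le_qmax by (meson order_trans)

lemma mmq_inv_start: "mmq_inv (Repeat_Loop Map.empty M)"
proof -
  have "deficit N qmin (Map.empty :: 'm \<rightharpoonup> 'n) \<le> card M"
    using sum_qmin by (simp add: deficit_def load_def assigned_def)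
  moreover have "partial_ok M Map.empty"
    by (simp add: partial_ok_def forced_def load_def assigned_def)
  moreover have "envy_closed qmax Map.empty"
    by (simp add: envy_closed_def)
  ultimately show ?thesis by (simp add: le_less disj_commute)
qed

text \<open>The exit test splits the final inequality: equality enters the while loop, strict
  inequality continues. If the deficit was strictly smaller before, the bound survives because the
  deficit does not grow and only one UE leaves.\<close>

lemma repeat_step:
  assumes inv: "mmq_inv (Repeat_Loop \<pi> M')"
    and m: "highest_ranked (utility_pref V) M' m"
    and n: "most_preferred N (ue m) qmax \<pi> n"
  shows "partial_ok (M' - {m}) (\<pi>(m \<mapsto> n))" "envy_closed qmax (\<pi>(m \<mapsto> n))"
    "deficit N qmin (\<pi>(m \<mapsto> n)) \<le> card (M' - {m})"
proof -
  have ok: "partial_ok M' \<pi>" and closed: "envy_closed qmax \<pi>"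
    using inv by auto
  have mM: "m \<in> M'" using m by (simp add: highest_ranked_def)
  note D = partial_okD[OF ok]
  show "partial_ok (M' - {m}) (\<pi>(m \<mapsto> n))"
    by (rule partial_ok_upd[OF ok m n order_refl])
      (use mM D(3) feasible_completion_below_qmax[OF finM] in blast)
  show "envy_closed qmax (\<pi>(m \<mapsto> n))"
    by (rule envy_closed_upd[OF ok m n closed])
  show "deficit N qmin (\<pi>(m \<mapsto> n)) \<le> card (M' - {m})"
  proof (cases "deficit N qmin \<pi> < card M'")
    case True
    then show ?thesis
      using deficit_upd_le[OF D(2) D(4)[OF mM], of N qmin n] mM D(1) by simp
  next
    \<comment> \<open>Only the first iteration with \<open>deficit\<close> equal to
      \<open>card M\<close> remains. Here \<open>tight\<close> ensures that the chosen BS has a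
      deficit, so both sides drop by one.\<close>
    case False
    then have empty: "\<pi> = Map.empty" and eq: "deficit N qmin \<pi> = card M'"
      using inv by auto
    then have "M' = M"
      using D(3) by simp
    then have "0 < qmin n"
      using tight[of m n] m n eq empty by (simp add: deficit_def load_def assigned_def)
    then have "load \<pi> n < qmin n"
      using empty by (simp add: load_def assigned_def)
    moreover have "n \<in> N" using n by (simp add: most_preferred_def)
    ultimately have "Suc (deficit N qmin (\<pi>(m \<mapsto> n))) = card M'"
      using Suc_deficit_upd[OF D(2) D(4)[OF mM] finN] eq by metis
    then show ?thesis
      using mM D(1) by simp
  qed
qed

lemma mmq_inv_step:
  assumes "step s s'" "mmq_inv s"
  shows "mmq_inv s'"
  using assms
proof (cases rule: mmq_step.cases)
  case (repeat_continue M' m \<pi> n \<pi>' M'')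
  then show ?thesis
    using repeat_step[of \<pi> M' m n] assms(2) by auto
next
  case (repeat_exit M' m \<pi> n \<pi>' M'')
  then show ?thesis
    using repeat_step[of \<pi> M' m n] assms(2) envy_closed_qmin by auto
next
  case (while_step M' m \<pi> n \<pi>' M'')
  have ok: "partial_ok M' \<pi>" and closed: "envy_closed qmin \<pi>" and eq: "deficit N qmin \<pi> = card M'"
    using while_step assms(2) by auto
  have mM: "m \<in> M'" using while_step by (simp add: highest_ranked_def)
  note D = partial_okD[OF ok]
  \<comment> \<open>The equality \<open>eq\<close> is what makes restricting the choice to BSs below
    \<open>qmin\<close> harmless: feasible completions obey the same restriction.\<close>
  have "partial_ok (M' - {m}) (\<pi>(m \<mapsto> n))"
    by (rule partial_ok_upd[OF ok while_step(3,4) qmin_le_qmax])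
      (use mM D(3) eq in \<open>auto intro: feasible_completion_below_qmin[OF finM finN, where m = m]\<close>)
  moreover have "envy_closed qmin (\<pi>(m \<mapsto> n))"
    by (rule envy_closed_upd[OF ok while_step(3,4) closed])
  moreover have "Suc (deficit N qmin (\<pi>(m \<mapsto> n))) = card M'"
    using Suc_deficit_upd[OF D(2) D(4)[OF mM] finN, of n qmin] eq while_step(4)
    by (simp add: most_preferred_def)
  then have "deficit N qmin (\<pi>(m \<mapsto> n)) = card (M' - {m})"
    using mM D(1) by simp
  ultimately show ?thesis
    using while_step by simp
qed

lemma mmq_inv_reachable: "step\<^sup>*\<^sup>* (Repeat_Loop Map.empty M) s \<Longrightarrow> mmq_inv s"
  by (induction rule: rtranclp_induct) (blast intro: mmq_inv_start mmq_inv_step)+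

section \<open>Termination and progress\<close>

fun unserved :: "('m, 'n) mmq_state \<Rightarrow> 'm set" where
  "unserved (Repeat_Loop \<pi> M') = M'"
| "unserved (While_Loop \<pi> M') = M'"

lemma card_unserved_step:
  assumes "step s s'" "mmq_inv s"
  shows "card (unserved s') < card (unserved s)"
proof -
  obtain m where "unserved s' = unserved s - {m}" "m \<in> unserved s"
    using assms(1) by cases (auto simp: highest_ranked_def)
  moreover have "finite (unserved s)"
    using assms(2) by (cases s) (auto dest: partial_okD(1))
  ultimately show ?thesis
    by (metis card_Diff1_less)
qed

lemma no_infinite_run:
  assumes start: "s 0 = Repeat_Loop Map.empty M"
  shows "\<not> (\<forall>i. step (s i) (s (Suc i)))"
proof
  assume run: "\<forall>i. step (s i) (s (Suc i))"
  have inv: "mmq_inv (s i)" for i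
    by (induction i) (use start run mmq_inv_start mmq_inv_step in auto)
  \<comment> \<open>Each step uses up at least one unserved UE, so the index
    \<open>Suc (card (unserved (s 0)))\<close> is already out of reach.\<close>
  have "card (unserved (s i)) + i \<le> card (unserved (s 0))" for i
  proof (induction i)
    case (Suc i)
    then show ?case
      using card_unserved_step[of "s i" "s (Suc i)"] run inv[of i] by simp
  qed simp
  from this[of "Suc (card (unserved (s 0)))"] show False by simp
qed

text \<open>Pigeonhole: if every BS were full, the served UEs alone would number at least the sum of
  the maximum quotas, hence at least \<open>card M\<close>.\<close>

lemma below_qmax_exists:
  assumes "partial_ok M' \<pi>" "M' \<noteq> {}"
  shows "\<exists>n\<in>N. load \<pi> n < qmax n"
proof (rule ccontr)
  assume "\<not> ?thesis"
  then have "(\<Sum>n\<in>N. qmax n) \<le> (\<Sum>n\<in>N. load \<pi> n)"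
    by (intro sum_mono) force
  also have "\<dots> = card (dom \<pi>)"
    using assms(1) finN partial_okD(2) by (intro sum_load) (auto simp: partial_ok_def)
  also have "\<dots> < card M"
    using assms finM by (intro psubset_card_mono) (auto simp: partial_ok_def)
  finally show False using sum_qmax by simp
qed

lemma repeat_progress:
  assumes "mmq_inv (Repeat_Loop \<pi> M')"
  shows "\<exists>s'. step (Repeat_Loop \<pi> M') s'"
proof -
  have ok: "partial_ok M' \<pi>" using assms by simp
  \<comment> \<open>Either \<open>card M'\<close> exceeds a natural number, or nobody has been
    served and \<open>M'\<close> is the nonempty \<open>M\<close>.\<close>
  have nonempty: "M' \<noteq> {}"
    using assms M_nonempty by (auto simp: partial_ok_def)
  obtain m where m: "highest_ranked (utility_pref V) M' m"
    using highest_ranked_exists[OF partial_okD(1)[OF ok] nonempty] by blast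
  obtain n where n: "most_preferred N (ue m) qmax \<pi> n"
    using most_preferred_exists[OF finN below_qmax_exists[OF ok nonempty]] by blast
  show ?thesis
  proof (cases "deficit N qmin (\<pi>(m \<mapsto> n)) = card (M' - {m})")
    case True
    then show ?thesis
      by (intro exI) (rule mmq_step.repeat_exit, rule m, rule n, simp_all)
  next
    case False
    then show ?thesis
      by (intro exI) (rule mmq_step.repeat_continue, rule m, rule n, simp_all)
  qed
qed

lemma while_progress:
  assumes "mmq_inv (While_Loop \<pi> M')" "M' \<noteq> {}"
  shows "\<exists>s'. step (While_Loop \<pi> M') s'"
proof -
  have fin: "finite M'" using assms(1) partial_okD(1) by auto
  \<comment> \<open>The deficit equals the positive number of unserved UEs, so some BS is below its
    minimum quota.\<close>
  then have "deficit N qmin \<pi> \<noteq> 0"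
    using assms by simp
  then have room: "\<exists>n\<in>N. load \<pi> n < qmin n"
    using finN by (auto simp: deficit_def not_le)
  obtain m where m: "highest_ranked (utility_pref V) M' m"
    using highest_ranked_exists[OF fin assms(2)] by blast
  obtain n where n: "most_preferred N (ue m) qmin \<pi> n"
    using most_preferred_exists[OF finN room] by blast
  show ?thesis
    using mmq_step.while_step[of "utility_pref V" M' m N ue qmin \<pi> n] m n by blast
qed

section \<open>Correctness of the final matching\<close>

lemma final_matching:
  assumes inv: "mmq_inv (While_Loop \<pi> {})"
    and bs: "\<And>n. n \<in> N \<Longrightarrow> bs_pref n = utility_pref V"
  shows "feasible M N qmin qmax \<pi>" "pareto_optimal M N qmin qmax ue \<pi>"
    "stable_matching M N ue bs_pref \<pi>"
proof -
  have dom: "dom \<pi> = M" and forced: "forced \<pi>" and closed: "envy_closed qmin \<pi>"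
    using inv by (auto simp: partial_ok_def)
  \<comment> \<open>With nobody unserved the deficit is 0, so every truncated difference in the sum
    vanishes and all minimum quotas are met.\<close>
  show "feasible M N qmin qmax \<pi>"
    using inv finN by (auto simp: feasible_def matching_def partial_ok_def deficit_def)
  \<comment> \<open>A weakly dominating feasible matching agrees with \<open>\<pi>\<close> on all of
    \<open>M\<close>, so no UE is strictly better off.\<close>
  have "\<pi> \<subseteq>\<^sub>m \<pi>'" if "feasible M N qmin qmax \<pi>'" "\<forall>m\<in>M. ue m (the (\<pi>' m)) (the (\<pi> m))" for \<pi>'
    using forced dom that by (auto simp: forced_def utility_pref_def)
  then show "pareto_optimal M N qmin qmax ue \<pi>"
    unfolding pareto_optimal_def map_le_def dom by (metis strict_pref_def)
  have "\<not> blocking_pair M N ue bs_pref \<pi> m n" for m n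
  proof
    assume "blocking_pair M N ue bs_pref \<pi> m n"
    then obtain m' where m: "m \<in> dom \<pi>" and n: "n \<in> N" and m': "m' \<in> assigned \<pi> n"
        and bs_pref: "strict_pref (bs_pref n) m m'" and ue_pref: "strict_pref (ue m) n (the (\<pi> m))"
      unfolding blocking_pair_def dom by blast
    have "V m' < V m" "U m (the (\<pi> m)) < U m n"
      using bs_pref ue_pref unfolding bs[OF n] strict_pref_def utility_pref_def by simp_all
    moreover from this have "V m \<le> V m'"
      using closed m n m' unfolding envy_closed_def by blast
    ultimately show False by simp
  qed
  then show "stable_matching M N ue bs_pref \<pi>"
    by (simp add: stable_matching_def)
qed

text \<open>By the progress lemmas, a reachable state without successor can be neither in the repeat
  loop nor in the while loop with unserved UEs.\<close>

lemma mmq_correct: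
  assumes "\<And>n. n \<in> N \<Longrightarrow> bs_pref n = utility_pref V"
  shows "mmq_guarantees M N qmin qmax ue (utility_pref V)
    (\<lambda>\<pi>. feasible M N qmin qmax \<pi> \<and> pareto_optimal M N qmin qmax ue \<pi> \<and>
         stable_matching M N ue bs_pref \<pi>)"
proof -
  have "\<exists>\<pi>. s = While_Loop \<pi> {} \<and> feasible M N qmin qmax \<pi> \<and>
      pareto_optimal M N qmin qmax ue \<pi> \<and> stable_matching M N ue bs_pref \<pi>"
    if "step\<^sup>*\<^sup>* (Repeat_Loop Map.empty M) s" "\<nexists>s'. step s s'" for s
  proof (cases s)
    case (Repeat_Loop \<pi> M')
    then show ?thesis
      using that mmq_inv_reachable repeat_progress by blast
  next
    case (While_Loop \<pi> M')
    moreover have "M' = {}"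
      using While_Loop that mmq_inv_reachable while_progress by blast
    ultimately show ?thesis
      using that(1) mmq_inv_reachable final_matching assms by blast
  qed
  then show ?thesis
    unfolding mmq_guarantees_def using no_infinite_run by blast
qed

end

theorem theorem1:
  fixes M :: "'m set" and N N1 N2 :: "'n set"
    and qmin qmax :: "'n \<Rightarrow> nat"
    and c_LoS c_NLoS c_uW :: "'m \<Rightarrow> 'n \<Rightarrow> real"
    and lam :: real and k t :: nat
    and kLoS :: "'m \<Rightarrow> 'n \<Rightarrow> nat \<Rightarrow> nat"
    and x :: "'m \<Rightarrow> 'n \<Rightarrow> nat \<Rightarrow> bool"
    and f :: "'m \<Rightarrow> 'n \<Rightarrow> nat \<Rightarrow> real"
    and U :: "'m \<Rightarrow> 'n \<Rightarrow> real"
    and ue_pref :: "'m \<Rightarrow> 'n \<Rightarrow> 'n \<Rightarrow> bool"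
    and bs_pref :: "'n \<Rightarrow> 'm \<Rightarrow> 'm \<Rightarrow> bool"
    and ml :: "'m \<Rightarrow> 'm \<Rightarrow> bool"
  assumes ues: "finite M" "M \<noteq> {}"
    and bss: "finite N" "N = N1 \<union> N2" "N1 \<inter> N2 = {}"
    and quotas: "\<And>n. n \<in> N \<Longrightarrow> qmin n \<le> qmax n"
    and enough_ues: "(\<Sum>n\<in>N. qmin n) \<le> card M"
    and enough_room: "card M \<le> (\<Sum>n\<in>N. qmax n)"
    and window: "0 \<le> lam" "lam \<le> 1" "0 < k"
      "\<And>m n s. m \<in> M \<Longrightarrow> n \<in> N1 \<Longrightarrow> kLoS m n s \<le> k"
    and f_init: "\<And>m n. m \<in> M \<Longrightarrow> n \<in> N1 \<Longrightarrow> 0 \<le> f m n 0 \<and> f m n 0 \<le> 1"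
    and f_update: "\<And>m n s. m \<in> M \<Longrightarrow> n \<in> N1 \<Longrightarrow>
      f m n (Suc s) =
        lam * (real (kLoS m n (Suc s)) * of_bool (x m n (Suc s)) / real k) + (1 - lam) * f m n s"
    and log_defined:
      "\<And>m n. m \<in> M \<Longrightarrow> n \<in> N1 \<Longrightarrow> 0 < mmw_rate (\<lambda>m n. f m n t) c_LoS c_NLoS m n"
      "\<And>m n. m \<in> M \<Longrightarrow> n \<in> N2 \<Longrightarrow> 0 < c_uW m n"
    and utility: "U = ue_utility N1 (\<lambda>m n. f m n t) c_LoS c_NLoS c_uW"
    and ue_preferences: "ue_pref = (\<lambda>m. utility_pref (U m))"
    and master_list: "ml = utility_pref (ml_utility N U)"
    and bs_preferences: "\<And>n. n \<in> N \<Longrightarrow> bs_pref n = ml"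
    and no_ue_ties: "\<And>m. m \<in> M \<Longrightarrow> inj_on (U m) N"
    and tight_quotas: "\<And>m n. (\<Sum>n\<in>N. qmin n) = card M \<Longrightarrow> highest_ranked ml M m \<Longrightarrow>
      most_preferred N (ue_pref m) qmax (Map.empty :: 'm \<rightharpoonup> 'n) n \<Longrightarrow> 0 < qmin n"
  shows "mmq_guarantees M N qmin qmax ue_pref ml
    (\<lambda>\<pi>. feasible M N qmin qmax \<pi> \<and>
         pareto_optimal M N qmin qmax ue_pref \<pi> \<and>
         stable_matching M N ue_pref bs_pref \<pi>)"
proof -
  interpret mmq_market M N qmin qmax U "ml_utility N U"
    using ues bss(1) quotas enough_ues enough_room no_ue_ties tight_quotas
    unfolding ue_preferences master_list by unfold_locales
  show ?thesis
    unfolding ue_preferences master_list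
    using bs_preferences by (intro mmq_correct) (simp add: master_list)
qed

end
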